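(* There exists an absolute constant $C>0$ such that for all integers $N\ge2$, $T\ge2$ there is an online algorithm which at each time $t$ plays a convex combination $p_t$ of $N$ strategies $S_1,\ldots,S_N$ (depending only on payoffs up to time $t-1$) with the following property. For every payoff sequence $s_{i,t}\in[-1,1]$, every covering of $\{1,\ldots,T\}$ by disjoint intervals $I_1,\ldots,I_k$, $I_j=[A_j,B_j]$, and every assignment of strategies $\eta_1,\ldots,\eta_k\in\{1,\ldots,N\}$ to the intervals, $$\text{gain}\ \ge\ \sum_{j=1}^k\left[S_{\eta_j}(I_j)-C\sqrt{|I_j|\log(NT)}\right],$$ where $\text{gain}=\sum_{t=1}^T\sum_{i=1}^Np_{i,t}s_{i,t}$ and $S_{\eta}(I)=\sum_{t\in I}s_{\eta,t}$ is the cumulative payoff of $S_\eta$ on $I$. The algorithm does not need to know $k$ or the intervals.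
   Context: Experts problem with full information: $N$ strategies have adversarial payoffs $s_{i,t}\in[-1,1]$, $t=1,\ldots,T$; at time $t$ the algorithm chooses weights $p_t$ in the probability simplex before the payoffs at time $t$ are revealed. *)

theory Defs
  imports Complex_Main "HOL-Library.Disjoint_Sets"
begin

(* Strategies are indexed by {1..N}, times by {1..T}; s i t is the payoff of
   strategy i at time t. Values of s outside these ranges are irrelevant junk. *)

definition payoffs :: "nat \<Rightarrow> nat \<Rightarrow> (nat \<Rightarrow> nat \<Rightarrow> real) \<Rightarrow> bool" where
  "payoffs N T s \<longleftrightarrow> (\<forall>i\<in>{1..N}. \<forall>t\<in>{1..T}. s i t \<in> {-1..1})"

definition simplex_weights :: "nat \<Rightarrow> (nat \<Rightarrow> real) \<Rightarrow> bool" where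
  "simplex_weights N w \<longleftrightarrow> (\<forall>i\<in>{1..N}. 0 \<le> w i) \<and> (\<Sum>i=1..N. w i) = 1"

(* p s t i is the weight put on strategy i at time t when the payoffs are s.
   Although p takes the whole payoff array as argument, the second conjunct says
   that p s t is determined by the payoffs of the N strategies at times 1,...,t-1;
   in particular the weights at time 1 are the same for all payoffs. *)
definition online_algorithm ::
  "nat \<Rightarrow> nat \<Rightarrow> ((nat \<Rightarrow> nat \<Rightarrow> real) \<Rightarrow> nat \<Rightarrow> nat \<Rightarrow> real) \<Rightarrow> bool" where
  "online_algorithm N T p \<longleftrightarrow>
     (\<forall>s. payoffs N T s \<longrightarrow> (\<forall>t\<in>{1..T}. simplex_weights N (p s t))) \<and>
     (\<forall>s s'. payoffs N T s \<longrightarrow> payoffs N T s' \<longrightarrow>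
        (\<forall>t\<in>{1..T}. (\<forall>i\<in>{1..N}. \<forall>u\<in>{1..<t}. s i u = s' i u) \<longrightarrow>
           (\<forall>i\<in>{1..N}. p s t i = p s' t i)))"

definition gain ::
  "nat \<Rightarrow> nat \<Rightarrow> ((nat \<Rightarrow> nat \<Rightarrow> real) \<Rightarrow> nat \<Rightarrow> nat \<Rightarrow> real) \<Rightarrow> (nat \<Rightarrow> nat \<Rightarrow> real) \<Rightarrow> real" where
  "gain N T p s = (\<Sum>t=1..T. \<Sum>i=1..N. p s t i * s i t)"

definition cum_payoff :: "(nat \<Rightarrow> nat \<Rightarrow> real) \<Rightarrow> nat \<Rightarrow> nat set \<Rightarrow> real" where
  "cum_payoff s i I = (\<Sum>t\<in>I. s i t)"

definition interval_partition ::
  "nat \<Rightarrow> nat \<Rightarrow> (nat \<Rightarrow> nat) \<Rightarrow> (nat \<Rightarrow> nat) \<Rightarrow> bool" where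
  "interval_partition T k A B \<longleftrightarrow>
     (\<forall>j\<in>{1..k}. A j \<le> B j) \<and>
     disjoint_family_on (\<lambda>j. {A j..B j}) {1..k} \<and>
     (\<Union>j\<in>{1..k}. {A j..B j}) = {1..T}"

end

(* For every strategy i and every interval [a,b] run a sleeping expert, awake on [a,b],
   whose weight is multiplied at each awake time by 1 + h a b * (s i t - g t), where g t is the
   gain of the algorithm at time t. Playing strategy i with probability proportional to the sum of
   h a b times the weight over the awake experts of i makes the total weight constant in time, so
   no single weight exceeds the number N T^2 of experts. Taking logarithms bounds the
   regret on every interval simultaneously by (2 ln (N T)) / h a b + 8 (h a b) |I|, and since the
   rate h a b may depend on the length of [a,b], it can be tuned for each interval separately. *)
theory Submission
  imports Defs
begin

section \<open>The sleeping-experts algorithm\<close>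

locale interval_experts =
  fixes N T :: nat and h :: "nat \<Rightarrow> nat \<Rightarrow> real"
  assumes N_pos: "N \<ge> 1"
    and h_pos: "h a b > 0"
    and h_le: "h a b \<le> 1 / 4"
begin

text \<open>The experts of i awake at t are the pairs with a \<le> t \<le> b. The factor
  \<open>h a b\<close> matches the step size of the update, so that the first-order changes of the
  weights cancel exactly.\<close>

definition awake_weight :: "(nat \<Rightarrow> nat \<Rightarrow> nat \<Rightarrow> real) \<Rightarrow> nat \<Rightarrow> nat \<Rightarrow> real" where
  "awake_weight w t i = (\<Sum>a=1..t. \<Sum>b=t..T. h a b * w i a b)"

definition play :: "(nat \<Rightarrow> nat \<Rightarrow> nat \<Rightarrow> real) \<Rightarrow> nat \<Rightarrow> nat \<Rightarrow> real" where
  "play w t i = awake_weight w t i / (\<Sum>j=1..N. awake_weight w t j)"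

text \<open>The state after time t, one table for all experts because \<open>play\<close> couples
  them. The gain is written out since \<open>strategy\<close> and \<open>regret\<close> are
  themselves defined from \<open>weight\<close>.\<close>

primrec weight :: "(nat \<Rightarrow> nat \<Rightarrow> real) \<Rightarrow> nat \<Rightarrow> nat \<Rightarrow> nat \<Rightarrow> nat \<Rightarrow> real" where
  "weight s 0 = (\<lambda>i a b. 1)"
| "weight s (Suc t) = (\<lambda>i a b. weight s t i a b *
     (if Suc t \<in> {a..b}
      then 1 + h a b * (s i (Suc t) - (\<Sum>j=1..N. play (weight s t) (Suc t) j * s j (Suc t)))
      else 1))"

text \<open>The shift to \<open>t - 1\<close> selects the state before the payoffs at time t are
  revealed.\<close>

definition strategy :: "(nat \<Rightarrow> nat \<Rightarrow> real) \<Rightarrow> nat \<Rightarrow> nat \<Rightarrow> real" where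
  "strategy s t = play (weight s (t - 1)) t"

definition regret :: "(nat \<Rightarrow> nat \<Rightarrow> real) \<Rightarrow> nat \<Rightarrow> nat \<Rightarrow> real" where
  "regret s i t = s i t - (\<Sum>j=1..N. strategy s t j * s j t)"

section \<open>Positive weights, convex play and dependence on the past\<close>

lemma weight_Suc:
  "weight s (Suc t) i a b = weight s t i a b *
     (if Suc t \<in> {a..b} then 1 + h a b * regret s i (Suc t) else 1)"
  by (simp add: regret_def strategy_def)

lemma awake_weight_pos:
  assumes "\<And>a b. w i a b > 0" "1 \<le> t" "t \<le> T"
  shows "awake_weight w t i > 0"
  unfolding awake_weight_def using assms h_pos by (intro sum_pos) auto

lemma simplex_play:
  assumes "\<And>i a b. i \<in> {1..N} \<Longrightarrow> w i a b > 0" "1 \<le> t" "t \<le> T"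
  shows "simplex_weights N (play w t)"
proof -
  have pos: "awake_weight w t i > 0" if "i \<in> {1..N}" for i
    using awake_weight_pos assms that by blast
  then have "(\<Sum>j=1..N. awake_weight w t j) > 0"
    using N_pos by (intro sum_pos) auto
  with pos show ?thesis
    by (auto simp: simplex_weights_def play_def less_imp_le sum_divide_distrib[symmetric])
qed

lemma regret_bounded:
  assumes s: "payoffs N T s" and i: "i \<in> {1..N}" and t: "t \<in> {1..T}"
    and p: "simplex_weights N (strategy s t)"
  shows "\<bar>regret s i t\<bar> \<le> 2"
proof -
  have b: "\<bar>s j t\<bar> \<le> 1" if "j \<in> {1..N}" for j
    using s t that by (force simp: payoffs_def abs_le_iff)
  have "\<bar>\<Sum>j=1..N. strategy s t j * s j t\<bar> \<le> (\<Sum>j=1..N. \<bar>strategy s t j * s j t\<bar>)"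
    by (rule sum_abs)
  also have "\<dots> \<le> (\<Sum>j=1..N. strategy s t j)"
    using p b by (intro sum_mono) (auto simp: abs_mult simplex_weights_def intro!: mult_left_le)
  also have "\<dots> = 1"
    using p by (simp add: simplex_weights_def)
  finally show ?thesis
    using b[OF i] unfolding regret_def by linarith
qed

text \<open>The bound 1/2 serves twice: it keeps the update factors positive, and it is the range in
  which ln (1 + x) is compared with x.\<close>

lemma abs_step_le_half:
  assumes "\<bar>r\<bar> \<le> 2"
  shows "\<bar>h a b * r\<bar> \<le> 1 / 2"
  using mult_mono[OF h_le[of a b] assms] h_pos[of a b] by (simp add: abs_mult)

text \<open>Positivity and convexity support each other: positive weights make the next play a
  convex combination, which bounds the regret by 2 and so keeps the next factor positive. Hence the
  induction runs over all experts at once.\<close>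

lemma weight_pos:
  assumes "payoffs N T s" "i \<in> {1..N}" "t \<le> T"
  shows "weight s t i a b > 0"
  using assms(2,3)
proof (induction t arbitrary: i a b)
  case (Suc t)
  have "simplex_weights N (strategy s (Suc t))"
    unfolding strategy_def using Suc by (intro simplex_play) auto
  then have "\<bar>regret s i (Suc t)\<bar> \<le> 2"
    using regret_bounded[OF assms(1)] Suc.prems by auto
  then have "1 + h a b * regret s i (Suc t) > 0"
    using abs_step_le_half[of "regret s i (Suc t)" a b] by linarith
  with Suc.IH[of i a b] Suc.prems show ?case
    by (simp only: weight_Suc) simp
qed simp

lemma simplex_strategy:
  assumes "payoffs N T s" "t \<in> {1..T}"
  shows "simplex_weights N (strategy s t)"
  unfolding strategy_def using assms weight_pos by (intro simplex_play) auto

text \<open>This yields the online property, as the play at time t uses the state after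
  \<open>t - 1\<close>. The gain mixes all strategies, so the induction keeps i arbitrary.\<close>

lemma weight_cong:
  assumes "\<And>i u. i \<in> {1..N} \<Longrightarrow> u \<in> {1..t} \<Longrightarrow> s i u = s' i u" and "i \<in> {1..N}"
  shows "weight s t i = weight s' t i"
  using assms
proof (induction t arbitrary: i)
  case (Suc t)
  have IH: "weight s t j = weight s' t j" if "j \<in> {1..N}" for j
    using Suc that by auto
  have "play (weight s t) (Suc t) j = play (weight s' t) (Suc t) j" if "j \<in> {1..N}" for j
    using IH that by (simp add: play_def awake_weight_def)
  then have "(\<Sum>j=1..N. play (weight s t) (Suc t) j * s j (Suc t)) =
      (\<Sum>j=1..N. play (weight s' t) (Suc t) j * s' j (Suc t))"
    using Suc.prems(1) by (intro sum.cong) auto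
  moreover have "s i (Suc t) = s' i (Suc t)"
    using Suc.prems by auto
  ultimately show ?case
    using IH[OF Suc.prems(2)] by (simp only: weight.simps)
qed simp

lemma online_strategy: "online_algorithm N T strategy"
proof -
  have "strategy s t i = strategy s' t i"
    if "t \<in> {1..T}" "\<forall>i\<in>{1..N}. \<forall>u\<in>{1..<t}. s i u = s' i u" "i \<in> {1..N}" for s s' t i
  proof -
    have "weight s (t - 1) j = weight s' (t - 1) j" if "j \<in> {1..N}" for j
      using that \<open>t \<in> {1..T}\<close> \<open>\<forall>i\<in>{1..N}. \<forall>u\<in>{1..<t}. s i u = s' i u\<close>
      by (intro weight_cong) auto
    then show ?thesis
      using that(3) by (simp add: strategy_def play_def awake_weight_def)
  qed
  then show ?thesis
    using simplex_strategy by (auto simp: online_algorithm_def)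
qed

section \<open>Conservation of the total weight\<close>

definition total_weight :: "(nat \<Rightarrow> nat \<Rightarrow> real) \<Rightarrow> nat \<Rightarrow> real" where
  "total_weight s t = (\<Sum>i=1..N. \<Sum>a=1..T. \<Sum>b=1..T. weight s t i a b)"

text \<open>The gain is the mean of the payoffs under the normalised awake weights, and weighted
  deviations from a mean cancel.\<close>

lemma awake_regret_zero:
  assumes s: "payoffs N T s" and t: "Suc t \<le> T"
  shows "(\<Sum>i=1..N. awake_weight (weight s t) (Suc t) i * regret s i (Suc t)) = 0"
proof -
  define V where "V = awake_weight (weight s t) (Suc t)"
  define Z where "Z = (\<Sum>j=1..N. V j)"
  define g where "g = (\<Sum>j=1..N. strategy s (Suc t) j * s j (Suc t))"
  have "V i > 0" if "i \<in> {1..N}" for i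
    unfolding V_def using weight_pos[OF s that] t by (intro awake_weight_pos) auto
  then have Z: "Z > 0"
    unfolding Z_def using N_pos by (intro sum_pos) auto
  have "Z * g = (\<Sum>j=1..N. V j * s j (Suc t))"
    unfolding g_def sum_distrib_left
  proof (intro sum.cong refl)
    fix j
    have "strategy s (Suc t) j = V j / Z"
      by (simp add: strategy_def play_def V_def Z_def)
    with Z show "Z * (strategy s (Suc t) j * s j (Suc t)) = V j * s j (Suc t)"
      by simp
  qed
  then show ?thesis
    unfolding regret_def V_def[symmetric] g_def[symmetric]
    by (simp add: right_diff_distrib sum_subtractf Z_def sum_distrib_right)
qed

lemma total_weight_Suc:
  assumes s: "payoffs N T s" and t: "Suc t \<le> T"
  shows "total_weight s (Suc t) = total_weight s t"
proof -
  \<comment> \<open>In the square of all pairs, those containing \<open>Suc t\<close> form the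
    rectangle over which \<open>awake_weight\<close> sums.\<close>
  have awake: "(\<Sum>a=1..T. \<Sum>b=1..T. if Suc t \<in> {a..b} then h a b * weight s t i a b else 0) =
      awake_weight (weight s t) (Suc t) i" for i
  proof -
    have "(\<Sum>b=1..T. if Suc t \<in> {a..b} then h a b * weight s t i a b else 0) =
        (if a \<in> {1..Suc t} then \<Sum>b=Suc t..T. h a b * weight s t i a b else 0)"
      if "a \<in> {1..T}" for a
      using that by (auto intro!: sum.mono_neutral_cong_right sum.neutral)
    then have "(\<Sum>a=1..T. \<Sum>b=1..T. if Suc t \<in> {a..b} then h a b * weight s t i a b else 0) =
        (\<Sum>a=1..T. if a \<in> {1..Suc t} then \<Sum>b=Suc t..T. h a b * weight s t i a b else 0)"
      by (intro sum.cong) auto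
    also have "\<dots> = awake_weight (weight s t) (Suc t) i"
      unfolding awake_weight_def using t by (intro sum.mono_neutral_cong_right) auto
    finally show ?thesis .
  qed
  have "total_weight s (Suc t) - total_weight s t =
      (\<Sum>i=1..N. (\<Sum>a=1..T. \<Sum>b=1..T. weight s (Suc t) i a b - weight s t i a b))"
    by (simp only: total_weight_def sum_subtractf)
  \<comment> \<open>Sleeping experts do not change. The regret depends only on i and the time, so it
    leaves the sums over a and b.\<close>
  also have "\<dots> = (\<Sum>i=1..N. (\<Sum>a=1..T. \<Sum>b=1..T.
      (if Suc t \<in> {a..b} then h a b * weight s t i a b else 0)) * regret s i (Suc t))"
    unfolding sum_distrib_right weight_Suc by (intro sum.cong refl) (simp add: algebra_simps)
  also have "\<dots> = 0"
    unfolding awake by (rule awake_regret_zero[OF s t])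
  finally show ?thesis by simp
qed

text \<open>All weights start at 1. Pairs with b < a are counted too; they never wake, and they make
  the count a plain product.\<close>

lemma total_weight_eq:
  assumes "payoffs N T s" "t \<le> T"
  shows "total_weight s t = real N * real T ^ 2"
  using assms(2)
proof (induction t)
  case 0
  then show ?case by (simp add: total_weight_def power2_eq_square)
next
  case (Suc t)
  then show ?case using total_weight_Suc[OF assms(1)] by simp
qed

lemma weight_le:
  assumes s: "payoffs N T s" and "i \<in> {1..N}" "a \<in> {1..T}" "b \<in> {1..T}" "t \<le> T"
  shows "weight s t i a b \<le> real N * real T ^ 2"
proof -
  have pos: "weight s t i' a' b' \<ge> 0" if "i' \<in> {1..N}" for i' a' b'
    using weight_pos[OF s that \<open>t \<le> T\<close>] less_imp_le by blast
  have "weight s t i a b \<le> (\<Sum>b=1..T. weight s t i a b)"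
    using pos assms by (intro member_le_sum) auto
  also have "\<dots> \<le> (\<Sum>a=1..T. \<Sum>b=1..T. weight s t i a b)"
    using pos assms by (intro member_le_sum[of a _ "\<lambda>a. \<Sum>b=1..T. weight s t i a b"] sum_nonneg) auto
  also have "\<dots> \<le> total_weight s t"
    unfolding total_weight_def
    using pos assms
    by (intro member_le_sum[of i _ "\<lambda>i. \<Sum>a=1..T. \<Sum>b=1..T. weight s t i a b"] sum_nonneg) auto
  finally show ?thesis
    using total_weight_eq[OF s \<open>t \<le> T\<close>] by simp
qed

section \<open>Regret on a single interval\<close>

lemma ln_weight_ge:
  assumes s: "payoffs N T s" and i: "i \<in> {1..N}" and "t \<le> T"
  shows "ln (weight s t i a b) \<ge> (\<Sum>u\<in>{1..t} \<inter> {a..b}. h a b * regret s i u - 8 * h a b ^ 2)"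
  using assms(3)
proof (induction t)
  case (Suc t)
  define r where "r = regret s i (Suc t)"
  have r: "\<bar>r\<bar> \<le> 2"
    unfolding r_def using Suc.prems by (intro regret_bounded[OF s i] simplex_strategy[OF s]) auto
  have x: "\<bar>h a b * r\<bar> \<le> 1 / 2" by (rule abs_step_le_half[OF r])
  have "r\<^sup>2 \<le> 4" using power_mono[OF r, of 2] by simp
  then have "(h a b * r)\<^sup>2 \<le> 4 * h a b ^ 2"
    using mult_left_mono[of "r\<^sup>2" 4 "h a b ^ 2"] by (simp add: power_mult_distrib)
  \<comment> \<open>From ln (1 + x) \<ge> x - 2 x^2 with x^2 \<le> 4 h^2; this is the source of the
    constant 8.\<close>
  with abs_ln_one_plus_x_minus_x_bound[OF x]
  have step: "ln (1 + h a b * r) \<ge> h a b * r - 8 * h a b ^ 2"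
    by linarith
  show ?case
  proof (cases "Suc t \<in> {a..b}")
    case True
    have "1 + h a b * r > 0" using x by linarith
    then have "ln (weight s (Suc t) i a b) = ln (weight s t i a b) + ln (1 + h a b * r)"
      unfolding weight_Suc r_def[symmetric]
      using True weight_pos[OF s i, of t a b] Suc.prems by (simp add: ln_mult)
    moreover have "{1..Suc t} \<inter> {a..b} = insert (Suc t) ({1..t} \<inter> {a..b})"
      using True by auto
    ultimately show ?thesis
      using Suc step by (simp add: r_def)
  next
    case False
    then have "{1..Suc t} \<inter> {a..b} = {1..t} \<inter> {a..b}"
      by (auto simp: le_Suc_eq)
    with Suc False show ?thesis
      by (simp only: weight_Suc) simp
  qed
qed simp

text \<open>The logarithm of the final weight is at least the accumulated regret up to second-order
  loss, and at most the logarithm of the total weight. Dividing by \<open>h a b\<close> gives the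
  bound.\<close>

lemma interval_regret:
  assumes s: "payoffs N T s" and i: "i \<in> {1..N}" and ab: "1 \<le> a" "a \<le> b" "b \<le> T"
  shows "(\<Sum>u=a..b. regret s i u) \<le>
    ln (real N * real T ^ 2) / h a b + 8 * h a b * real (card {a..b})"
proof -
  have "{1..T} \<inter> {a..b} = {a..b}" using ab by auto
  then have "h a b * (\<Sum>u=a..b. regret s i u) - 8 * h a b ^ 2 * real (card {a..b}) \<le>
      ln (weight s T i a b)"
    using ln_weight_ge[OF s i order_refl, of a b]
    by (simp only: sum_subtractf sum_distrib_left sum_constant mult.commute)
  also have "\<dots> \<le> ln (real N * real T ^ 2)"
    using weight_le[OF s i, of a b T] weight_pos[OF s i order_refl, of a b] ab
    by simp
  finally have "h a b * (\<Sum>u=a..b. regret s i u) \<le>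
      h a b * (ln (real N * real T ^ 2) / h a b + 8 * h a b * real (card {a..b}))"
    using h_pos[of a b] by (simp add: distrib_left power2_eq_square mult.assoc mult.left_commute)
  then show ?thesis
    using h_pos[of a b] by simp
qed

end

section \<open>Tuned rates and summation over a partition\<close>

lemma sum_interval_partition:
  assumes "interval_partition T k A B"
  shows "(\<Sum>t=1..T. f t) = (\<Sum>j=1..k. \<Sum>t=A j..B j. f t)"
proof -
  have "(\<Sum>t=1..T. f t) = sum f (\<Union>j\<in>{1..k}. {A j..B j})"
    using assms by (simp add: interval_partition_def)
  also have "\<dots> = (\<Sum>j=1..k. \<Sum>t=A j..B j. f t)"
    using assms by (intro sum.UNION_disjoint_family) (auto simp: interval_partition_def)
  finally show ?thesis .
qed

text \<open>This rate turns both terms into multiples of sqrt (n L), with factors 8 and 2.\<close>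

lemma tuned_rate_bound:
  fixes L n :: real
  assumes "0 < L" "L \<le> n"
  shows "2 * L / (sqrt (L / n) / 4) + 8 * (sqrt (L / n) / 4) * n = 10 * sqrt (n * L)"
proof -
  have "sqrt (L / n) * n = sqrt (n * L)" "L / sqrt (L / n) = sqrt (n * L)"
    using assms by (simp_all add: real_sqrt_divide real_sqrt_mult field_simps)
  moreover have "2 * L / (sqrt (L / n) / 4) + 8 * (sqrt (L / n) / 4) * n =
      8 * (L / sqrt (L / n)) + 2 * (sqrt (L / n) * n)"
    by simp
  ultimately show ?thesis by simp
qed

lemma tuned_strategy:
  fixes N T :: nat
  assumes NT: "N \<ge> 2" "T \<ge> 2"
  obtains p where "online_algorithm N T p"
    "\<And>s i a b. payoffs N T s \<Longrightarrow> i \<in> {1..N} \<Longrightarrow> 1 \<le> a \<Longrightarrow> a \<le> b \<Longrightarrow> b \<le> T \<Longrightarrow>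
      (\<Sum>t=a..b. s i t - (\<Sum>j=1..N. p s t j * s j t)) \<le>
      10 * sqrt (real (card {a..b}) * ln (real N * real T))"
proof -
  define L where "L = ln (real N * real T)"
  have "1 * 1 < real N * real T" using NT by (intro mult_strict_mono) auto
  then have L: "L > 0" by (simp add: L_def)
  \<comment> \<open>The minimum enforces the cap 1/4. \<open>Suc (b - a)\<close> is the length when
    a \<le> b and stays positive for all other pairs.\<close>
  define h where "h a b = min 1 (sqrt (L / real (Suc (b - a)))) / 4" for a b :: nat
  interpret interval_experts N T h
    using NT L by unfold_locales (auto simp: h_def)
  have lnNT: "ln (real N * real T ^ 2) \<le> 2 * L"
  proof -
    have "real N * real T ^ 2 \<le> (real N * real T) ^ 2"
      using NT by (simp add: power_mult_distrib power2_eq_square)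
    then have "ln (real N * real T ^ 2) \<le> ln ((real N * real T) ^ 2)"
      using NT by (subst ln_le_cancel_iff) auto
    also have "\<dots> = 2 * L" using NT by (simp add: L_def ln_realpow)
    finally show ?thesis .
  qed
  have "(\<Sum>t=a..b. regret s i t) \<le> 10 * sqrt (real (card {a..b}) * L)"
    if s: "payoffs N T s" and i: "i \<in> {1..N}" and ab: "1 \<le> a" "a \<le> b" "b \<le> T" for s i a b
  proof -
    define n where "n = real (card {a..b})"
    have n: "n = real (Suc (b - a))" "n > 0" using ab by (auto simp: n_def)
    \<comment> \<open>If L \<le> n, the cap is not exceeded and the tuned rate applies. On shorter
      intervals the trivial bound 2 n is already at most 2 sqrt (n L).\<close>
    show ?thesis
    proof (cases "L \<le> n")
      case True
      then have "L / n \<le> 1" using n L by simp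
      then have rate: "h a b = sqrt (L / n) / 4"
        using ab n by (simp add: h_def min_def)
      have "(\<Sum>t=a..b. regret s i t) \<le> 2 * L / h a b + 8 * h a b * n"
        using interval_regret[OF s i ab] divide_right_mono[OF lnNT, of "h a b"] h_pos[of a b]
        unfolding n_def by linarith
      also have "\<dots> = 10 * sqrt (n * L)"
        unfolding rate by (rule tuned_rate_bound[OF L True])
      finally show ?thesis by (simp add: n_def)
    next
      case False
      have "\<bar>regret s i t\<bar> \<le> 2" if "t \<in> {a..b}" for t
        using that ab by (intro regret_bounded[OF s i] simplex_strategy[OF s]) auto
      then have "(\<Sum>t=a..b. regret s i t) \<le> (\<Sum>t=a..b. 2)"
        by (intro sum_mono) (simp add: abs_le_iff)
      also have "\<dots> = 2 * sqrt (n * n)" using n by (simp add: n_def)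
      also have "\<dots> \<le> 10 * sqrt (n * L)"
        using n False by (intro mult_mono real_sqrt_le_mono mult_left_mono) auto
      finally show ?thesis by (simp add: n_def)
    qed
  qed
  then show thesis
    using that[OF online_strategy] unfolding regret_def L_def by blast
qed

theorem theorem4:
  shows "\<exists>C::real. C > 0 \<and>
    (\<forall>N T :: nat. N \<ge> 2 \<longrightarrow> T \<ge> 2 \<longrightarrow>
      (\<exists>p. online_algorithm N T p \<and>
        (\<forall>s k A B \<eta>.
           payoffs N T s \<longrightarrow>
           interval_partition T k A B \<longrightarrow>
           (\<forall>j\<in>{1..k}. \<eta> j \<in> {1..N}) \<longrightarrow>
           gain N T p s \<ge>
             (\<Sum>j=1..k. cum_payoff s (\<eta> j) {A j..B j}
                - C * sqrt (real (card {A j..B j}) * ln (real N * real T))))))"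
proof (rule exI[of _ 10], intro conjI allI impI)
  fix N T :: nat
  assume "N \<ge> 2" "T \<ge> 2"
  then obtain p where online: "online_algorithm N T p"
    and bound: "\<And>s i a b. payoffs N T s \<Longrightarrow> i \<in> {1..N} \<Longrightarrow> 1 \<le> a \<Longrightarrow> a \<le> b \<Longrightarrow> b \<le> T \<Longrightarrow>
      (\<Sum>t=a..b. s i t - (\<Sum>j=1..N. p s t j * s j t)) \<le>
      10 * sqrt (real (card {a..b}) * ln (real N * real T))"
    using tuned_strategy by blast
  have "gain N T p s \<ge> (\<Sum>j=1..k. cum_payoff s (\<eta> j) {A j..B j}
      - 10 * sqrt (real (card {A j..B j}) * ln (real N * real T)))"
    if s: "payoffs N T s" and part: "interval_partition T k A B"
      and \<eta>: "\<forall>j\<in>{1..k}. \<eta> j \<in> {1..N}" for s k A B \<eta>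
  proof -
    have "cum_payoff s (\<eta> j) {A j..B j}
        - 10 * sqrt (real (card {A j..B j}) * ln (real N * real T))
        \<le> (\<Sum>t=A j..B j. \<Sum>i=1..N. p s t i * s i t)" if j: "j \<in> {1..k}" for j
    proof -
      have le: "A j \<le> B j" using part j by (auto simp: interval_partition_def)
      \<comment> \<open>The inclusion constrains the endpoints because the interval is nonempty by
        \<open>le\<close>.\<close>
      have "{A j..B j} \<subseteq> {1..T}"
        using part j unfolding interval_partition_def by blast
      with le have "1 \<le> A j" "B j \<le> T" by auto
      from bound[OF s _ this(1) le this(2), of "\<eta> j"] \<eta> j show ?thesis
        by (simp add: cum_payoff_def sum_subtractf)
    qed
    then show ?thesis
      unfolding gain_def sum_interval_partition[OF part] by (rule sum_mono)
  qed
  with online show "\<exists>p. online_algorithm N T p \<and>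
        (\<forall>s k A B \<eta>.
           payoffs N T s \<longrightarrow>
           interval_partition T k A B \<longrightarrow>
           (\<forall>j\<in>{1..k}. \<eta> j \<in> {1..N}) \<longrightarrow>
           gain N T p s \<ge>
             (\<Sum>j=1..k. cum_payoff s (\<eta> j) {A j..B j}
                - 10 * sqrt (real (card {A j..B j}) * ln (real N * real T))))"
    by blast
qed simp

end
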